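(* Let $(K,\rho)$ be a complete metric space that is not a singleton. (a) If $K$ is local, then $K$ has property $(Z)$. (b) If $K$ is compact and has property $(Z)$, then $K$ is local.
   Context: For a metric space $(K,\rho)$, the space of all Lipschitz functions $f\colon K\to\mathbb{R}$ carries the seminorm $$\|f\|=\sup\Bigl\{\frac{|f(t_1)-f(t_2)|}{\rho(t_1,t_2)} : t_1\neq t_2\in K\Bigr\}.$$ $\mathrm{Lip}(K)$ denotes the Banach space obtained by quotienting out the constant functions, with the induced norm; its elements are referred to as functions. $K$ is called local if for every $\varepsilon>0$ and every $f\in\mathrm{Lip}(K)$ there are two distinct points $\tau_1,\tau_2\in K$ such that $\rho(\tau_1,\tau_2)<\varepsilon$ and $$\frac{f(\tau_2)-f(\tau_1)}{\rho(\tau_1,\tau_2)}>\|f\|-\varepsilon.$$ $K$ has property $(Z)$ if for all distinct $t,\tau\in K$ and every $\varepsilon>0$ there is some $z\in K\setminus\{t,\tau\}$ satisfying $$\rho(t,z)+\rho(z,\tau)\le\rho(t,\tau)+\varepsilon\min\{\rho(z,t),\rho(z,\tau)\}.$$ *)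

theory Defs
  imports "HOL-Analysis.Analysis"
begin

text \<open>
  A metric space is given as a subset \<open>K\<close> of a type of class \<^class>\<open>metric_space\<close>, with the
  induced metric. Functions on \<open>K\<close> are total functions on the ambient type of which only
  the values on \<open>K\<close> are ever used.
\<close>

definition lipschitz_functions :: "'a::metric_space set \<Rightarrow> ('a \<Rightarrow> real) set" where
  "lipschitz_functions K = {f. \<exists>L. L-lipschitz_on K f}"

text \<open>
  The supremum is taken in the conditionally complete type \<^typ>\<open>real\<close>; it is a genuine supremum
  when \<open>f\<close> is Lipschitz on \<open>K\<close> and \<open>K\<close> has at least two points.
\<close>

definition lip_norm :: "'a::metric_space set \<Rightarrow> ('a \<Rightarrow> real) \<Rightarrow> real" where
  "lip_norm K f = Sup {\<bar>f t1 - f t2\<bar> / dist t1 t2 | t1 t2. t1 \<in> K \<and> t2 \<in> K \<and> t1 \<noteq> t2}"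

text \<open>
  An element of \<open>Lip(K)\<close> is a Lipschitz function modulo constants. The condition below only
  involves differences of values of \<open>f\<close>, so it does not depend on the representative.
\<close>

definition local_space :: "'a::metric_space set \<Rightarrow> bool" where
  "local_space K \<longleftrightarrow>
    (\<forall>\<epsilon>>0. \<forall>f\<in>lipschitz_functions K. \<exists>\<tau>1\<in>K. \<exists>\<tau>2\<in>K. \<tau>1 \<noteq> \<tau>2 \<and>
      dist \<tau>1 \<tau>2 < \<epsilon> \<and> (f \<tau>2 - f \<tau>1) / dist \<tau>1 \<tau>2 > lip_norm K f - \<epsilon>)"

definition property_Z :: "'a::metric_space set \<Rightarrow> bool" where
  "property_Z K \<longleftrightarrow>
    (\<forall>t\<in>K. \<forall>\<tau>\<in>K. t \<noteq> \<tau> \<longrightarrow> (\<forall>\<epsilon>>0. \<exists>z\<in>K - {t, \<tau>}.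
      dist t z + dist z \<tau> \<le> dist t \<tau> + \<epsilon> * min (dist z t) (dist z \<tau>)))"

end

theory Submission
  imports Defs
begin

text \<open>
  Both parts compare the slopes \<open>(f q - f p) / dist p q\<close> of a Lipschitz function with their
  supremum \<open>lip_norm K f\<close>.

  (a) Suppose property (Z) fails at \<open>t\<close>, \<open>\<tau>\<close>: every detour from \<open>t\<close> to \<open>\<tau>\<close> through a third point
  exceeds the distance \<open>d\<close> of the two points by a definite proportion of the distance from the
  third point to the nearer of them. Put a cone of height
  \<open>d / 2\<close> and slope \<open>1 - \<delta>\<close> on \<open>t\<close> and the negative of such a cone on \<open>\<tau>\<close>. The resulting function
  rises by \<open>d\<close> from \<open>\<tau>\<close> to \<open>t\<close>, so its norm is at least \<open>1\<close>. A slope above \<open>1 - \<delta>\<close> can only be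
  seen from a point \<open>q\<close> of the lower cone to a point \<open>p\<close> of the upper one, and the cost of the
  detours through \<open>p\<close> and through \<open>q\<close> forbids it as soon as \<open>dist p q \<le> d / 2\<close>
  (lemma \<open>two_cones_slope_bound\<close>). Hence \<open>K\<close> is not local.

  (b) Suppose \<open>K\<close> is compact and some \<open>f\<close> has no slope within \<open>\<epsilon>\<close> of its norm \<open>L\<close> at distances
  below \<open>\<epsilon>\<close>. Slopes are continuous on the compact set of pairs at distance at least \<open>\<epsilon>\<close>, so some
  pair attains the slope \<open>L\<close> (lemma \<open>lip_norm_attained\<close>). A point \<open>z\<close> supplied by (Z) splits
  such a pair \<open>(t, \<tau>)\<close> into two pairs that both have almost the slope \<open>L\<close>
  (lemma \<open>slopes_of_split_pair\<close>), and the shorter one has distance at most \<open>2 / 3 * dist t \<tau>\<close>.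
  By compactness again, the slope \<open>L\<close> is attained at distance at most \<open>2 / 3 * dist t \<tau>\<close>. So
  the distances of the pairs of slope \<open>L\<close> have infimum zero, although none is below \<open>\<epsilon>\<close>.
\<close>

section \<open>Slopes and the Lipschitz seminorm\<close>

lemma slope_le_lip_norm:
  assumes "f \<in> lipschitz_functions K" "p \<in> K" "q \<in> K" "p \<noteq> q"
  shows "(f q - f p) / dist p q \<le> lip_norm K f"
proof -
  let ?S = "{\<bar>f t1 - f t2\<bar> / dist t1 t2 | t1 t2. t1 \<in> K \<and> t2 \<in> K \<and> t1 \<noteq> t2}"
  obtain C where C: "C-lipschitz_on K f"
    using assms(1) by (auto simp: lipschitz_functions_def)
  have "bdd_above ?S"
  proof (rule bdd_aboveI)
    fix x assume "x \<in> ?S"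
    then obtain a b where x: "x = \<bar>f a - f b\<bar> / dist a b" and ab: "a \<in> K" "b \<in> K" "a \<noteq> b"
      by blast
    have "\<bar>f a - f b\<bar> \<le> C * dist a b"
      using lipschitz_onD[OF C ab(1,2)] by (simp add: dist_real_def)
    then show "x \<le> C"
      using ab(3) by (simp add: x divide_le_eq)
  qed
  moreover have "\<bar>f q - f p\<bar> / dist q p \<in> ?S"
    using assms by blast
  ultimately have "\<bar>f q - f p\<bar> / dist q p \<le> lip_norm K f"
    unfolding lip_norm_def by (rule cSup_upper[rotated])
  moreover have "(f q - f p) / dist p q \<le> \<bar>f q - f p\<bar> / dist q p"
    by (simp add: dist_commute divide_right_mono)
  ultimately show ?thesis
    by linarith
qed

lemma increment_le_lip_norm:
  assumes "f \<in> lipschitz_functions K" "p \<in> K" "q \<in> K"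
  shows "f q - f p \<le> lip_norm K f * dist p q"
  using slope_le_lip_norm[OF assms] by (cases "p = q") (auto simp: divide_le_eq)

text \<open>Signed slopes suffice to approximate the norm: exchanging the points changes the sign.\<close>

lemma slope_near_lip_norm:
  assumes "a \<in> K" "b \<in> K" "a \<noteq> b" and "c < lip_norm K f"
  obtains p q where "p \<in> K" "q \<in> K" "p \<noteq> q" "c < (f q - f p) / dist p q"
proof -
  let ?S = "{\<bar>f t1 - f t2\<bar> / dist t1 t2 | t1 t2. t1 \<in> K \<and> t2 \<in> K \<and> t1 \<noteq> t2}"
  have "?S \<noteq> {}"
    using assms by blast
  then obtain x where "x \<in> ?S" "c < x"
    using assms(4) less_cSupD unfolding lip_norm_def by meson
  then obtain u v where uv: "u \<in> K" "v \<in> K" "u \<noteq> v" "c < \<bar>f u - f v\<bar> / dist u v"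
    by blast
  show thesis
  proof (cases "f u \<le> f v")
    case True
    then show thesis using uv that[of u v] by simp
  next
    case False
    then show thesis using uv that[of v u] by (simp add: dist_commute)
  qed
qed

section \<open>Local spaces have property (Z)\<close>

text \<open>
  The constants: \<open>\<delta> \<le> 1 / 4\<close> confines the support of each cone to a ball of radius \<open>2 * d / 3\<close>,
  on which the distance to the own apex is at most twice the distance to the other one, so that the
  minimum in (Z) is at least half the distance to the own apex. Averaging the detour costs through
  \<open>p\<close> and \<open>q\<close> halves the gain again, and of the remaining \<open>\<epsilon> / 4 \<ge> 2 * \<delta>\<close> one \<open>\<delta>\<close> pays for the
  reduced slope of the cones. The other one makes the slope drop below \<open>1 - \<delta>\<close> at short distances.
\<close>

lemma two_cones_slope_bound:
  fixes K :: "'a::metric_space set" and t \<tau> :: 'a and \<delta> :: real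
  defines "g \<equiv> \<lambda>c z. max (dist t \<tau> / 2 - (1 - \<delta>) * dist c z) 0"
  assumes detour: "\<And>z. z \<in> K - {t, \<tau>} \<Longrightarrow>
      dist t \<tau> + \<epsilon> * min (dist z t) (dist z \<tau>) < dist t z + dist z \<tau>"
    and \<delta>: "0 < \<delta>" "\<delta> \<le> 1 / 4" "8 * \<delta> \<le> \<epsilon>"
    and pq: "p \<in> K" "q \<in> K" "dist p q \<le> dist t \<tau> / 2"
  shows "(g t p - g \<tau> p) - (g t q - g \<tau> q) \<le> (1 - \<delta>) * dist p q"
proof -
  let ?d = "dist t \<tau>"
  have cone_Lipschitz: "g c x - g c y \<le> (1 - \<delta>) * dist x y" for c x y
  proof -
    have "dist c y \<le> dist c x + dist x y"
      by (rule dist_triangle)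
    then have "(1 - \<delta>) * dist c y \<le> (1 - \<delta>) * (dist c x + dist x y)"
      using \<delta> by (intro mult_left_mono) auto
    moreover have "0 \<le> (1 - \<delta>) * dist x y"
      using \<delta> by simp
    ultimately show ?thesis
      unfolding g_def by (simp add: algebra_simps max_def)
  qed
  have nonneg: "0 \<le> g c z" for c z
    by (simp add: g_def)
  consider "g \<tau> q = 0" | "g t p = 0" | "0 < g t p" "0 < g \<tau> q"
    using nonneg less_eq_real_def by metis
  then show ?thesis
  proof cases
    case 1
    then show ?thesis
      using cone_Lipschitz[of t p q] nonneg[of \<tau> p] by linarith
  next
    case 2
    then show ?thesis
      using cone_Lipschitz[of \<tau> q p] nonneg[of t q] by (simp add: dist_commute)
  next
    case 3
    define A where "A = dist t p"
    define B where "B = dist \<tau> q"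
    have supp: "dist c z \<le> 2 * ?d / 3" if "0 < g c z" for c z
    proof -
      have "(1 - \<delta>) * dist c z < ?d / 2"
        using that by (simp add: g_def less_max_iff_disj)
      moreover have "3 / 4 * dist c z \<le> (1 - \<delta>) * dist c z"
        using \<delta> by (intro mult_right_mono) auto
      ultimately show ?thesis by linarith
    qed
    have A: "A \<le> 2 * ?d / 3" and B: "B \<le> 2 * ?d / 3"
      using 3 supp unfolding A_def B_def by auto
    have tri: "?d \<le> A + dist p \<tau>" "?d \<le> B + dist q t"
      using dist_triangle[of t \<tau> p] dist_triangle[of t \<tau> q]
      unfolding A_def B_def by (simp_all add: dist_commute)
    have "?d \<noteq> 0"
      using 3 \<delta> unfolding g_def by (auto simp: less_max_iff_disj mult_less_0_iff)
    then have d: "?d > 0" by simp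
    have detour_p: "?d + \<epsilon> * (A / 2) \<le> A + dist p \<tau>"
    proof (cases "p = t")
      case False
      moreover have "p \<noteq> \<tau>"
        using A d unfolding A_def by auto
      ultimately have "?d + \<epsilon> * min (dist p t) (dist p \<tau>) < dist t p + dist p \<tau>"
        using detour pq by blast
      moreover have "\<epsilon> * (A / 2) \<le> \<epsilon> * min (dist p t) (dist p \<tau>)"
        using \<delta> A tri(1) unfolding A_def
        by (intro mult_left_mono) (auto simp: dist_commute)
      ultimately show ?thesis unfolding A_def by linarith
    qed (simp add: A_def)
    have detour_q: "?d + \<epsilon> * (B / 2) \<le> B + dist q t"
    proof (cases "q = \<tau>")
      case False
      moreover have "q \<noteq> t"
        using B d unfolding B_def by (auto simp: dist_commute)
      ultimately have "?d + \<epsilon> * min (dist q t) (dist q \<tau>) < dist t q + dist q \<tau>"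
        using detour pq by blast
      moreover have "\<epsilon> * (B / 2) \<le> \<epsilon> * min (dist q t) (dist q \<tau>)"
        using \<delta> B tri(2) unfolding B_def
        by (intro mult_left_mono) (auto simp: dist_commute)
      ultimately show ?thesis unfolding B_def by (simp add: dist_commute)
    qed (simp add: B_def dist_commute)
    have "dist p \<tau> \<le> dist p q + B" "dist q t \<le> dist p q + A"
      using dist_triangle[of p \<tau> q] dist_triangle[of q t p]
      unfolding A_def B_def by (simp_all add: dist_commute)
    then have "?d + \<epsilon> * (A / 2) \<le> A + (dist p q + B)" "?d + \<epsilon> * (B / 2) \<le> B + (dist p q + A)"
      using detour_p detour_q by auto
    from add_mono[OF this] have "?d + \<epsilon> / 4 * (A + B) \<le> A + B + dist p q"
      by (simp add: field_simps)
    moreover have "(\<delta> + \<delta>) * (A + B) \<le> \<epsilon> / 4 * (A + B)"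
      using \<delta> by (intro mult_right_mono) (auto simp: A_def B_def)
    ultimately have "?d + (\<delta> + \<delta>) * (A + B) \<le> A + B + dist p q"
      by (rule order_trans[OF add_left_mono, rotated])
    moreover have "\<delta> * dist p q \<le> \<delta> * (A + B)"
    proof (rule mult_left_mono)
      have "?d \<le> A + B + dist p q"
        using tri(1) \<open>dist p \<tau> \<le> dist p q + B\<close> by linarith
      then show "dist p q \<le> A + B"
        using pq(3) by linarith
    qed (use \<delta> in simp)
    ultimately have "?d - (1 - \<delta>) * (A + B) \<le> (1 - \<delta>) * dist p q"
      by (simp add: algebra_simps)
    moreover have "g t p + g \<tau> q = ?d - (1 - \<delta>) * (A + B)"
      using 3 unfolding g_def A_def B_def
      by (simp add: less_max_iff_disj algebra_simps)
    ultimately show ?thesis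
      using nonneg[of \<tau> p] nonneg[of t q] by linarith
  qed
qed

lemma local_space_imp_property_Z:
  assumes "local_space K"
  shows "property_Z K"
proof (rule ccontr)
  assume "\<not> property_Z K"
  then obtain t \<tau> \<epsilon> where t: "t \<in> K" "\<tau> \<in> K" "t \<noteq> \<tau>" and "0 < \<epsilon>"
    and detour: "\<And>z. z \<in> K - {t, \<tau>} \<Longrightarrow>
      dist t \<tau> + \<epsilon> * min (dist z t) (dist z \<tau>) < dist t z + dist z \<tau>"
    unfolding property_Z_def by (meson not_le)
  define \<delta> where "\<delta> = min (1 / 4) (\<epsilon> / 8)"
  have \<delta>: "0 < \<delta>" "\<delta> \<le> 1 / 4" "8 * \<delta> \<le> \<epsilon>"
    using \<open>0 < \<epsilon>\<close> by (auto simp: \<delta>_def)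
  define g where "g = (\<lambda>(c::'a) z. max (dist t \<tau> / 2 - (1 - \<delta>) * dist c z) 0)"
  define f where "f = (\<lambda>z. g t z - g \<tau> z)"
  have truncation: "\<bar>max (h - a) 0 - max (h - b) 0\<bar> \<le> \<bar>a - b\<bar>" for h a b :: real
    by linarith
  have cone: "1-lipschitz_on K (g c)" for c
  proof (rule lipschitz_onI)
    fix x y
    have *: "\<bar>dist c x - dist c y\<bar> \<le> dist x y"
      by (smt (verit) dist_commute dist_triangle2)
    have "\<bar>g c x - g c y\<bar> \<le> \<bar>(1 - \<delta>) * dist c x - (1 - \<delta>) * dist c y\<bar>"
      unfolding g_def by (rule truncation)
    also have "\<dots> = (1 - \<delta>) * \<bar>dist c x - dist c y\<bar>"
      using \<delta> by (simp add: abs_mult flip: right_diff_distrib)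
    also have "\<dots> \<le> 1 * dist x y"
      using * \<delta> by (intro mult_mono) auto
    finally show "dist (g c x) (g c y) \<le> 1 * dist x y"
      by (simp add: dist_real_def)
  qed simp
  have f: "f \<in> lipschitz_functions K"
    using lipschitz_on_diff[OF cone cone] unfolding f_def lipschitz_functions_def by blast
  have "g t t = dist t \<tau> / 2" "g \<tau> \<tau> = dist t \<tau> / 2"
    by (simp_all add: g_def)
  moreover have "g t \<tau> = 0" "g \<tau> t = 0"
  proof -
    have "1 / 2 * dist t \<tau> \<le> (1 - \<delta>) * dist t \<tau>"
      using \<delta> by (intro mult_right_mono) auto
    then show "g t \<tau> = 0" "g \<tau> t = 0"
      by (simp_all add: g_def dist_commute)
  qed
  ultimately have "f t - f \<tau> = dist \<tau> t"
    by (simp add: f_def dist_commute)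
  then have norm: "1 \<le> lip_norm K f"
    using slope_le_lip_norm[OF f t(2,1)] t(3) by simp
  define \<eta> where "\<eta> = min \<delta> (dist t \<tau> / 2)"
  have "0 < \<eta>"
    using \<delta> t by (simp add: \<eta>_def)
  then obtain q p where pq: "p \<in> K" "q \<in> K" "q \<noteq> p" "dist q p < \<eta>"
    and slope: "lip_norm K f - \<eta> < (f p - f q) / dist q p"
    using assms f unfolding local_space_def by meson
  have "f p - f q \<le> (1 - \<delta>) * dist p q"
    unfolding f_def g_def
    by (rule two_cones_slope_bound[OF detour \<delta> pq(1,2)])
      (use pq(4) in \<open>auto simp: \<eta>_def dist_commute\<close>)
  then have "(f p - f q) / dist q p \<le> 1 - \<delta>"
    using pq(3) by (simp add: divide_le_eq dist_commute)
  with slope norm show False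
    by (simp add: \<eta>_def)
qed

section \<open>Compact spaces with property (Z) are local\<close>

text \<open>
  On pairs whose distance is bounded away from zero the slope is continuous, so compactness turns
  approximation of the norm into attainment.
\<close>

lemma lip_norm_attained:
  assumes f: "f \<in> lipschitz_functions K" and "compact D" and "D \<subseteq> K \<times> K"
    and off_diagonal: "\<And>x. x \<in> D \<Longrightarrow> fst x \<noteq> snd x"
    and near: "\<And>c. c < lip_norm K f \<Longrightarrow> \<exists>(p, q)\<in>D. c < (f q - f p) / dist p q"
  obtains p q where "(p, q) \<in> D" "f q - f p = lip_norm K f * dist p q"
proof -
  define s where "s = (\<lambda>x. (f (snd x) - f (fst x)) / dist (fst x) (snd x))"
  have fK: "continuous_on K f"
    using f lipschitz_on_continuous_on unfolding lipschitz_functions_def by blast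
  have "continuous_on D s"
    unfolding s_def using \<open>D \<subseteq> K \<times> K\<close> off_diagonal
    by (intro continuous_intros continuous_on_compose2[OF fK]) auto
  moreover have "D \<noteq> {}"
    using near[of "lip_norm K f - 1"] by auto
  ultimately obtain x where x: "x \<in> D" "\<And>y. y \<in> D \<Longrightarrow> s y \<le> s x"
    using continuous_attains_sup[OF \<open>compact D\<close>] by metis
  have "\<not> s x < lip_norm K f"
    using near[of "s x"] x(2) unfolding s_def by fastforce
  moreover have "s x \<le> lip_norm K f"
    unfolding s_def using slope_le_lip_norm[OF f] x(1) \<open>D \<subseteq> K \<times> K\<close> off_diagonal by auto
  ultimately have "s x = lip_norm K f"
    by simp
  then have "f (snd x) - f (fst x) = lip_norm K f * dist (fst x) (snd x)"
    using off_diagonal[OF x(1)] by (auto simp: s_def field_simps)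
  then show thesis
    using that[of "fst x" "snd x"] x(1) by simp
qed

text \<open>
  Neither half of a split pair can have slope above \<open>L\<close>, so a half of slope noticeably below \<open>L\<close>
  would prevent the increments from adding up to \<open>L * dist t \<tau>\<close>.
\<close>

lemma slopes_of_split_pair:
  assumes f: "f \<in> lipschitz_functions K" and K: "t \<in> K" "\<tau> \<in> K" "z \<in> K"
    and extremal: "f \<tau> - f t = L * dist t \<tau>" and L: "L = lip_norm K f" "0 \<le> L"
    and z: "z \<noteq> t" "z \<noteq> \<tau>"
      "dist t z + dist z \<tau> \<le> dist t \<tau> + \<eta> * min (dist z t) (dist z \<tau>)" and "0 \<le> \<eta>"
  shows "L - L * \<eta> \<le> (f z - f t) / dist t z" "L - L * \<eta> \<le> (f \<tau> - f z) / dist z \<tau>"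
proof -
  have total: "L * (dist t z + dist z \<tau>) \<le> f \<tau> - f t + L * \<eta> * min (dist z t) (dist z \<tau>)"
    using mult_left_mono[OF z(3) L(2)] extremal by (simp add: algebra_simps)
  have halves: "f z - f t \<le> L * dist t z" "f \<tau> - f z \<le> L * dist z \<tau>"
    using increment_le_lip_norm[OF f] K L(1) by auto
  have "0 \<le> L * \<eta>"
    using L(2) \<open>0 \<le> \<eta>\<close> by simp
  then have min: "L * \<eta> * min (dist z t) (dist z \<tau>) \<le> L * \<eta> * dist t z"
      "L * \<eta> * min (dist z t) (dist z \<tau>) \<le> L * \<eta> * dist z \<tau>"
    by (auto intro!: mult_left_mono simp: dist_commute)
  have "(L - L * \<eta>) * dist t z \<le> f z - f t" "(L - L * \<eta>) * dist z \<tau> \<le> f \<tau> - f z"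
    using total halves min by (simp_all add: algebra_simps)
  then show "L - L * \<eta> \<le> (f z - f t) / dist t z" "L - L * \<eta> \<le> (f \<tau> - f z) / dist z \<tau>"
    using z by (simp_all add: le_divide_eq)
qed

lemma lip_norm_nonneg:
  assumes "f \<in> lipschitz_functions K" "a \<in> K" "b \<in> K" "a \<noteq> b"
  shows "0 \<le> lip_norm K f"
proof -
  have "f b - f a \<le> lip_norm K f * dist a b" "f a - f b \<le> lip_norm K f * dist a b"
    using increment_le_lip_norm[OF assms(1)] assms(2,3) by (metis dist_commute)+
  then have "0 \<le> lip_norm K f * dist a b"
    by linarith
  then show ?thesis
    using assms(4) by (simp add: zero_le_mult_iff)
qed

lemma compact_property_Z_imp_local_space:
  fixes K :: "'a::metric_space set"
  assumes "compact K" and Z: "property_Z K" and ab: "a \<in> K" "b \<in> K" "a \<noteq> b"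
  shows "local_space K"
proof (rule ccontr)
  assume "\<not> local_space K"
  then obtain \<epsilon> f where "0 < \<epsilon>" and f: "f \<in> lipschitz_functions K"
    and no_slope: "\<forall>p\<in>K. \<forall>q\<in>K. \<not> (p \<noteq> q \<and> dist p q < \<epsilon> \<and>
      lip_norm K f - \<epsilon> < (f q - f p) / dist p q)"
    unfolding local_space_def by blast
  define L where "L = lip_norm K f"
  have far: "\<epsilon> \<le> dist p q"
    if "p \<in> K" "q \<in> K" "p \<noteq> q" "L - \<epsilon> < (f q - f p) / dist p q" for p q
    using no_slope that unfolding L_def by (meson not_le)
  have "0 \<le> L"
    using lip_norm_nonneg[OF f ab] by (simp add: L_def)
  define H where "H = K \<times> K \<inter> {x. \<epsilon> \<le> dist (fst x) (snd x)}"
  have "compact H"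
    unfolding H_def
    by (intro compact_Int_closed compact_Times closed_Collect_le continuous_intros \<open>compact K\<close>)
  have H: "x \<in> K \<times> K" "fst x \<noteq> snd x" if "x \<in> H" for x
    using that \<open>0 < \<epsilon>\<close> by (auto simp: H_def)
  define E where "E = {x \<in> H. f (snd x) - f (fst x) = L * dist (fst x) (snd x)}"
  have "E \<noteq> {}"
  proof -
    have "\<exists>(p, q)\<in>H. c < (f q - f p) / dist p q" if "c < lip_norm K f" for c
    proof -
      have "max c (L - \<epsilon>) < lip_norm K f"
        using that \<open>0 < \<epsilon>\<close> by (simp add: L_def)
      from slope_near_lip_norm[OF ab this] obtain p q
        where "p \<in> K" "q \<in> K" "p \<noteq> q" "max c (L - \<epsilon>) < (f q - f p) / dist p q" .
      then show ?thesis
        using far[of p q] by (auto simp: H_def intro!: bexI[of _ "(p, q)"])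
    qed
    then obtain p q where "(p, q) \<in> H" "f q - f p = L * dist p q"
      using lip_norm_attained[OF f \<open>compact H\<close>] H unfolding L_def by blast
    then show ?thesis
      by (auto simp: E_def)
  qed
  have shorten: "\<exists>y\<in>E. dist (fst y) (snd y) \<le> 2 / 3 * dist t \<tau>" if "(t, \<tau>) \<in> E" for t \<tau>
  proof -
    let ?D = "H \<inter> {x. dist (fst x) (snd x) \<le> 2 / 3 * dist t \<tau>}"
    have t: "t \<in> K" "\<tau> \<in> K" "t \<noteq> \<tau>" and extremal: "f \<tau> - f t = L * dist t \<tau>"
      using that H[of "(t, \<tau>)"] by (auto simp: E_def)
    have "\<exists>(p, q)\<in>?D. c < (f q - f p) / dist p q" if "c < lip_norm K f" for c
    proof -
      define \<theta> where "\<theta> = min (L - c) \<epsilon>"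
      have "0 < \<theta>"
        using that \<open>0 < \<epsilon>\<close> by (simp add: \<theta>_def L_def)
      \<comment> \<open>The halves of a split pair may lose \<open>L * \<eta>\<close>, which has to stay below \<open>\<theta>\<close>;
        dividing by \<open>L + 1\<close> covers \<open>L = 0\<close>.\<close>
      define \<eta> where "\<eta> = min (1 / 2) (\<theta> / (L + 1))"
      have \<eta>: "0 < \<eta>" "\<eta> \<le> 1 / 2"
      proof -
        show "0 < \<eta>"
          using \<open>0 < \<theta>\<close> \<open>0 \<le> L\<close> by (simp add: \<eta>_def)
        show "\<eta> \<le> 1 / 2"
          unfolding \<eta>_def by (rule min.cobounded1)
      qed
      have "L * \<eta> < (L + 1) * \<eta>"
        using \<eta> by simp
      also have "\<dots> \<le> (L + 1) * (\<theta> / (L + 1))"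
        using \<open>0 \<le> L\<close> by (intro mult_left_mono) (auto simp: \<eta>_def)
      also have "\<dots> = \<theta>"
        using \<open>0 \<le> L\<close> by simp
      finally have loss: "c < L - L * \<eta>" "L - \<epsilon> < L - L * \<eta>"
        by (auto simp: \<theta>_def)
      obtain z where z: "z \<in> K" "z \<noteq> t" "z \<noteq> \<tau>"
        and split: "dist t z + dist z \<tau> \<le> dist t \<tau> + \<eta> * min (dist z t) (dist z \<tau>)"
        using Z t \<eta>(1) unfolding property_Z_def by blast
      note slopes = slopes_of_split_pair[OF f t(1,2) z(1) extremal L_def \<open>0 \<le> L\<close> z(2,3) split
          less_imp_le[OF \<eta>(1)]]
      \<comment> \<open>The shorter half \<open>m\<close> satisfies \<open>2 * m \<le> dist t \<tau> + m / 2\<close>.\<close>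
      have "\<eta> * min (dist z t) (dist z \<tau>) \<le> 1 / 2 * min (dist z t) (dist z \<tau>)"
        using \<eta> by (intro mult_right_mono) auto
      then have "min (dist t z) (dist z \<tau>) \<le> 2 / 3 * dist t \<tau>"
        using split by (auto simp: dist_commute min_def split: if_splits)
      then consider "dist t z \<le> 2 / 3 * dist t \<tau>" | "dist z \<tau> \<le> 2 / 3 * dist t \<tau>"
        unfolding min_le_iff_disj by meson
      then show ?thesis
      proof cases
        case 1
        have "\<epsilon> \<le> dist t z"
          using far[of t z] t z slopes(1) loss(2) by auto
        then show ?thesis
          using 1 t z slopes(1) loss(1) by (auto simp: H_def intro!: bexI[of _ "(t, z)"])
      next
        case 2
        have "\<epsilon> \<le> dist z \<tau>"
          using far[of z \<tau>] t z slopes(2) loss(2) by auto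
        then show ?thesis
          using 2 t z slopes(2) loss(1) by (auto simp: H_def intro!: bexI[of _ "(z, \<tau>)"])
      qed
    qed
    moreover have "compact ?D"
      by (intro compact_Int_closed closed_Collect_le continuous_intros \<open>compact H\<close>)
    ultimately obtain p q where "(p, q) \<in> ?D" "f q - f p = L * dist p q"
      using lip_norm_attained[OF f, of ?D] H unfolding L_def by blast
    then show ?thesis
      by (auto simp: E_def intro!: bexI[of _ "(p, q)"])
  qed
  define d where "d = (INF x\<in>E. dist (fst x) (snd x))"
  have lower: "\<epsilon> \<le> d"
    unfolding d_def using \<open>E \<noteq> {}\<close> by (intro cINF_greatest) (auto simp: E_def H_def)
  \<comment> \<open>Shortening a pair of distance below \<open>5 / 4 * d\<close> gives one of distance below \<open>5 / 6 * d\<close>.\<close>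
  then have "d < 5 / 4 * d"
    using \<open>0 < \<epsilon>\<close> by simp
  moreover have bdd: "bdd_below ((\<lambda>x. dist (fst x) (snd x)) ` E)"
    by (rule bdd_belowI2[of _ 0]) simp
  ultimately obtain x where x: "x \<in> E" "dist (fst x) (snd x) < 5 / 4 * d"
    using cINF_less_iff[OF \<open>E \<noteq> {}\<close> bdd, of "5 / 4 * d"] by (auto simp flip: d_def)
  obtain y where "y \<in> E" "dist (fst y) (snd y) \<le> 2 / 3 * dist (fst x) (snd x)"
    using shorten[of "fst x" "snd x"] x(1) by auto
  moreover have "d \<le> dist (fst y) (snd y)"
    unfolding d_def by (rule cINF_lower[OF bdd \<open>y \<in> E\<close>])
  ultimately show False
    using x(2) lower \<open>0 < \<epsilon>\<close> by linarith
qed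

theorem proposition2p8:
  fixes K :: "'a::metric_space set"
  assumes "complete K" and "K \<noteq> {}" and "\<not> is_singleton K"
  shows "(local_space K \<longrightarrow> property_Z K) \<and>
         (compact K \<and> property_Z K \<longrightarrow> local_space K)"
proof -
  obtain a b where "a \<in> K" "b \<in> K" "a \<noteq> b"
    using assms(2,3) by (metis is_singletonI' ex_in_conv)
  then show ?thesis
    using local_space_imp_property_Z compact_property_Z_imp_local_space by blast
qed

end
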